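(* Let $s\ge e^8$ be an integer, let $\ell=\left\lceil\frac{s}{\ln s}\right\rceil$, and let $n=(100s-1)s^\ell$. Then there exists an edge-pancyclic graph $G$ with $n$ vertices and at least one edge such that $$|E(G)|\leq 2n-\frac{n}{200\ln n}.$$
   Context: All graphs are finite and simple. A graph $G$ with $n$ vertices is edge-pancyclic if, for every integer $k$ with $3\leq k\leq n$, every edge of $G$ lies in a cycle of $G$ of length $k$. Here $e$ in $e^8$ is the base of the natural logarithm $\ln$. *)

theory Defs
  imports Complex_Main
begin

definition simple_graph :: "'a set \<Rightarrow> 'a set set \<Rightarrow> bool" where
  "simple_graph V E \<longleftrightarrow> finite V \<and> E \<subseteq> {e. e \<subseteq> V \<and> card e = 2}"

(* The closed sequence c!0, c!1, ..., c!(length c - 1), c!0. *)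
definition cycle_edges :: "'a list \<Rightarrow> 'a set set" where
  "cycle_edges c = {{c ! i, c ! (Suc i mod length c)} | i. i < length c}"

(* A cycle is given by the list of its distinct vertices in cyclic order, so the length
   of the cycle (its number of edges) is the length of the list. *)
definition is_cycle :: "'a set \<Rightarrow> 'a set set \<Rightarrow> 'a list \<Rightarrow> bool" where
  "is_cycle V E c \<longleftrightarrow>
     3 \<le> length c \<and> distinct c \<and> set c \<subseteq> V \<and> cycle_edges c \<subseteq> E"

definition edge_pancyclic :: "'a set \<Rightarrow> 'a set set \<Rightarrow> bool" where
  "edge_pancyclic V E \<longleftrightarrow>
     (\<forall>k\<in>{3..card V}. \<forall>e\<in>E. \<exists>c. is_cycle V E c \<and> length c = k \<and> e \<in> cycle_edges c)"

end

theory Submission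
  imports Defs
begin

text \<open>
A wheel on \<open>n\<close> vertices is edge-pancyclic with
\<open>2n - 2\<close> edges, and gluing wheels without a rim edge in a ring, end to end, saves one edge per
wheel compared with two edges per vertex. What fails in such a ring is the range of cycle lengths: an edge lies on short
cycles inside its piece and on long cycles around the ring, with nothing in between. The
construction below gives the ring shortcuts at all scales without spending the savings.

A graph with two ends \<open>a\<close> and \<open>b\<close> is a block if it has paths from \<open>a\<close> to \<open>b\<close> on every number of
vertices from 5 to all, and if for each of its edges the lengths of the cycles through it
within the block reach up to some \<open>L\<close>, while paths through it from \<open>a\<close> to \<open>b\<close> exist on every number
of vertices from some \<open>l \<le> L - 4\<close> to all. Two blocks with the same ends and
otherwise disjoint form an edge-pancyclic graph (\<open>block_parallel\<close>): when the cycles inside one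
block stop, the paths leaving it can already be closed up in the other.

The basic block is a double fan (\<open>double_fan_cap\<close>): two fans whose rims share an end,
with adjacent hubs. It has \<open>m\<close> vertices and at most \<open>2m - 3\<close> edges. Two blocks in series have lost
the overlap between \<open>l\<close> and \<open>L\<close>, and their shortest end-to-end path is longer. Both defects are
repaired by attaching a double fan at each end such that these two have a hub in common
(\<open>capped_slot\<close>): the hub bypasses everything in between, and it also closes up the paths across
the enclosed part into cycles at the cost of a single vertex.

Enclosing something in this way costs exactly two edges per new vertex, and putting one more
double fan in series before doing so saves one edge. Each round therefore
saves one edge on 65 new vertices, with the same constants in every round
(\<open>sparse_blocks\<close>). This yields edge-pancyclic graphs with at most \<open>2n - n/65\<close> edges for every
\<open>n \<ge> 44\<close> (\<open>sparse_edge_pancyclic\<close>), and the claim follows since \<open>200 ln n \<ge> 65\<close>.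
\<close>

section \<open>Paths and cycles of many lengths\<close>

fun path_edges :: "'a list \<Rightarrow> 'a set set" where
  "path_edges (x # y # zs) = insert {x, y} (path_edges (y # zs))"
| "path_edges _ = {}"

lemma path_edges_append:
  "xs \<noteq> [] \<Longrightarrow> ys \<noteq> [] \<Longrightarrow>
    path_edges (xs @ ys) = path_edges xs \<union> {{last xs, hd ys}} \<union> path_edges ys"
proof (induction xs)
  case (Cons x xs)
  then show ?case by (cases xs; cases ys) auto
qed simp

lemma path_edges_Cons: "ys \<noteq> [] \<Longrightarrow> path_edges (x # ys) = insert {x, hd ys} (path_edges ys)"
  by (cases ys) auto

lemma path_edges_rev [simp]: "path_edges (rev xs) = path_edges xs"
proof (induction xs)
  case (Cons x xs)
  show ?case
  proof (cases "xs = []")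
    case False
    then show ?thesis
      using Cons by (simp add: path_edges_append path_edges_Cons last_rev insert_commute)
  qed simp
qed simp

lemma path_edges_conv_nth: "path_edges xs = {{xs ! i, xs ! Suc i} | i. Suc i < length xs}"
proof (induction xs rule: path_edges.induct)
  case (1 x y zs)
  have "{{(x # y # zs) ! i, (x # y # zs) ! Suc i} | i. Suc i < length (x # y # zs)} =
        insert {x, y} {{(y # zs) ! i, (y # zs) ! Suc i} | i. Suc i < length (y # zs)}"
    (is "?L = ?R")
  proof
    show "?L \<subseteq> ?R"
    proof
      fix e assume "e \<in> ?L"
      then obtain i where i: "e = {(x # y # zs) ! i, (x # y # zs) ! Suc i}"
        "Suc i < length (x # y # zs)" by blast
      then show "e \<in> ?R" by (cases i) auto
    qed
    show "?R \<subseteq> ?L"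
    proof
      fix e assume "e \<in> ?R"
      then consider "e = {x, y}" | i where "e = {(y # zs) ! i, (y # zs) ! Suc i}"
        "Suc i < length (y # zs)" by blast
      then show "e \<in> ?L"
      proof cases
        case 1 then show ?thesis by (auto intro: exI[of _ 0])
      next
        case (2 i) then show ?thesis by (auto intro: exI[of _ "Suc i"])
      qed
    qed
  qed
  then show ?case using 1 by simp
qed auto

text \<open>Cycles are handled as closed walks from here on, so that the append rules for paths apply
to them and no index arithmetic modulo the length is left.\<close>
lemma cycle_edges_conv_path_edges:
  assumes "c \<noteq> []" shows "cycle_edges c = path_edges (c @ [hd c])"
proof -
  have "{c ! i, c ! (Suc i mod length c)} = {(c @ [hd c]) ! i, (c @ [hd c]) ! Suc i}"
    if "i < length c" for i
    using that assms by (cases "Suc i = length c") (auto simp: nth_append hd_conv_nth)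
  then show ?thesis
    unfolding cycle_edges_def path_edges_conv_nth by fastforce
qed

lemma card_path_edges_le: "card (path_edges xs) \<le> length xs - 1"
proof (induction xs rule: path_edges.induct)
  case (1 x y zs)
  then show ?case using card_insert_le_m1[of "length (y # zs)" "path_edges (y # zs)" "{x,y}"] by simp
qed auto

lemma path_edges_simple: "distinct xs \<Longrightarrow> e \<in> path_edges xs \<Longrightarrow> e \<subseteq> set xs \<and> card e = 2"
  by (induction xs rule: path_edges.induct) auto

text \<open>The vertex set is a parameter of its own, independent of the edges: a gadget is analysed in
pieces that all live in one ambient edge set, and only the regions of vertices that the
pieces may visit have to be kept apart.\<close>
definition path :: "'a set \<Rightarrow> 'a set set \<Rightarrow> 'a list \<Rightarrow> 'a \<Rightarrow> 'a \<Rightarrow> bool" where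
  "path V E p a b \<longleftrightarrow>
     p \<noteq> [] \<and> hd p = a \<and> last p = b \<and> distinct p \<and> set p \<subseteq> V \<and> path_edges p \<subseteq> E"

text \<open>The unit of bookkeeping is a whole interval of path orders, where the order is the number
of vertices. Intervals add up under concatenation without leaving holes, which reduces
every length argument below to comparing endpoints. The set \<open>X\<close> collects edges that each
of the paths has to use; in practice it is empty or a single edge.\<close>
definition spans :: "'a set \<Rightarrow> 'a set set \<Rightarrow> 'a \<Rightarrow> 'a \<Rightarrow> 'a set set \<Rightarrow> nat \<Rightarrow> nat \<Rightarrow> bool" where
  "spans V E a b X m n \<longleftrightarrow>
     (\<forall>k\<in>{m..n}. \<exists>p. path V E p a b \<and> length p = k \<and> X \<subseteq> path_edges p)"

definition rings :: "'a set \<Rightarrow> 'a set set \<Rightarrow> 'a set set \<Rightarrow> nat \<Rightarrow> nat \<Rightarrow> bool" where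
  "rings V E X m n \<longleftrightarrow>
     (\<forall>k\<in>{m..n}. \<exists>c. is_cycle V E c \<and> length c = k \<and> X \<subseteq> cycle_edges c)"

lemma spans_mono:
  assumes "spans V E a b X m n" "V \<subseteq> V'" "E \<subseteq> E'" "X' \<subseteq> X" "m \<le> m'" "n' \<le> n"
  shows "spans V' E' a b X' m' n'"
  unfolding spans_def
proof
  fix k assume "k \<in> {m'..n'}"
  then have "k \<in> {m..n}" using assms(5,6) by simp
  then obtain p where "path V E p a b" "length p = k" "X \<subseteq> path_edges p"
    using assms(1) unfolding spans_def by blast
  then show "\<exists>p. path V' E' p a b \<and> length p = k \<and> X' \<subseteq> path_edges p"
    using assms(2-4) unfolding path_def by (intro exI[of _ p]) auto
qed

lemma rings_mono:
  assumes "rings V E X m n" "V \<subseteq> V'" "E \<subseteq> E'" "X' \<subseteq> X" "m \<le> m'" "n' \<le> n"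
  shows "rings V' E' X' m' n'"
  unfolding rings_def
proof
  fix k assume "k \<in> {m'..n'}"
  then have "k \<in> {m..n}" using assms(5,6) by simp
  then obtain c where "is_cycle V E c" "length c = k" "X \<subseteq> cycle_edges c"
    using assms(1) unfolding rings_def by blast
  then show "\<exists>c. is_cycle V' E' c \<and> length c = k \<and> X' \<subseteq> cycle_edges c"
    using assms(2-4) unfolding is_cycle_def by (intro exI[of _ c]) auto
qed

lemma spans_join:
  assumes "spans V E a b X m n" "spans V E a b X m' n'" "m' \<le> Suc n"
  shows "spans V E a b X m n'"
  unfolding spans_def
proof
  fix k assume "k \<in> {m..n'}"
  then have "k \<in> {m..n} \<or> k \<in> {m'..n'}" using assms(3) by auto
  then show "\<exists>p. path V E p a b \<and> length p = k \<and> X \<subseteq> path_edges p"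
    using assms(1,2) unfolding spans_def by blast
qed

lemma rings_join:
  assumes "rings V E X m n" "rings V E X m' n'" "m' \<le> Suc n"
  shows "rings V E X m n'"
  unfolding rings_def
proof
  fix k assume "k \<in> {m..n'}"
  then have "k \<in> {m..n} \<or> k \<in> {m'..n'}" using assms(3) by auto
  then show "\<exists>c. is_cycle V E c \<and> length c = k \<and> X \<subseteq> cycle_edges c"
    using assms(1,2) unfolding rings_def by blast
qed

lemma path_rev: "path V E p a b \<Longrightarrow> path V E (rev p) b a"
  unfolding path_def by (simp add: hd_rev last_rev)

lemma spansI: "(\<And>k. m \<le> k \<Longrightarrow> k \<le> n \<Longrightarrow> spans V E a b X k k) \<Longrightarrow> spans V E a b X m n"
  unfolding spans_def by simp

lemma ringsI: "(\<And>k. m \<le> k \<Longrightarrow> k \<le> n \<Longrightarrow> rings V E X k k) \<Longrightarrow> rings V E X m n"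
  unfolding rings_def by simp

lemma spans_rev:
  assumes "spans V E a b X m n"
  shows "spans V E b a X m n"
  unfolding spans_def
proof
  fix k assume "k \<in> {m..n}"
  then obtain p where "path V E p a b" "length p = k" "X \<subseteq> path_edges p"
    using assms unfolding spans_def by blast
  then show "\<exists>p. path V E p b a \<and> length p = k \<and> X \<subseteq> path_edges p"
    using path_rev by (intro exI[of _ "rev p"]) auto
qed

lemma spans_supergraph: "spans V E a b X m n \<Longrightarrow> E \<subseteq> E' \<Longrightarrow> spans V E' a b X m n"
  by (erule spans_mono) auto

lemma spans_sym: "spans V E a b X m n \<longleftrightarrow> spans V E b a X m n"
  by (rule iffI; erule spans_rev)

lemma pathI_spans:
  "path V E p a b \<Longrightarrow> length p = k \<Longrightarrow> X \<subseteq> path_edges p \<Longrightarrow> spans V E a b X k k"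
  unfolding spans_def by auto

lemma spans_edge: "{a, b} \<in> E \<Longrightarrow> a \<noteq> b \<Longrightarrow> spans {a, b} E a b {{a, b}} 2 2"
  by (rule pathI_spans[of _ _ "[a, b]"]) (auto simp: path_def)

lemma interval_sum_split:
  fixes m n m' n' k :: nat
  assumes "m \<le> n" "m' \<le> n'" "m + m' \<le> k" "k \<le> n + n'"
  obtains i j where "i \<in> {m..n}" "j \<in> {m'..n'}" "i + j = k"
proof (cases "k - m' \<le> n")
  case True
  then show ?thesis using assms that[of "k - m'" m'] by auto
next
  case False
  then show ?thesis using assms that[of n "k - n"] by auto
qed

text \<open>The orders of the two paths are added and the shared vertex is counted once. The slack in
\<open>U\<close>, \<open>Z\<close>, \<open>lo\<close> and \<open>hi\<close> lets each use state the region and the interval it wants.\<close>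
lemma spans_series:
  assumes 1: "spans V E a b X m n" and 2: "spans W E b c Y m' n'"
    and disj: "V \<inter> W \<subseteq> {b}" and ne: "m \<le> n" "m' \<le> n'"
    and U: "V \<union> W \<subseteq> U" and Z: "Z \<subseteq> X \<union> Y"
    and lo: "m + m' \<le> Suc lo" and hi: "Suc hi \<le> n + n'"
  shows "spans U E a c Z lo hi"
  unfolding spans_def
proof
  fix k assume "k \<in> {lo..hi}"
  then have "m + m' \<le> Suc k" "Suc k \<le> n + n'" using lo hi by auto
  then obtain i j where ij: "i \<in> {m..n}" "j \<in> {m'..n'}" "i + j = Suc k"
    using interval_sum_split[OF ne] by metis
  obtain p where p: "path V E p a b" "length p = i" "X \<subseteq> path_edges p"
    using 1 ij(1) unfolding spans_def by blast
  obtain q where q: "path W E q b c" "length q = j" "Y \<subseteq> path_edges q"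
    using 2 ij(2) unfolding spans_def by blast
  obtain q' where q': "q = b # q'" using q(1) unfolding path_def by (cases q) auto
  have edges: "path_edges (p @ q') = path_edges p \<union> path_edges q"
  proof (cases "q' = []")
    case False
    then show ?thesis using p(1) q' by (auto simp: path_def path_edges_append path_edges_Cons)
  qed (simp add: q')
  have "set p \<inter> set q' = {}"
    using p(1) q(1) disj unfolding path_def q' by fastforce
  then have "path U E (p @ q') a c"
    using p(1) q(1) U edges unfolding path_def q' by (auto simp: last_append)
  moreover have "length (p @ q') = k" using p(2) q(2) q' ij(3) by simp
  ultimately show "\<exists>p. path U E p a c \<and> length p = k \<and> Z \<subseteq> path_edges p"
    using edges p(3) q(3) Z by blast
qed

lemma is_cycleI_walk:
  assumes "distinct c" "3 \<le> length c" "set c \<subseteq> V" "path_edges (c @ [hd c]) \<subseteq> E"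
  shows "is_cycle V E c"
  using assms cycle_edges_conv_path_edges[of c] unfolding is_cycle_def by fastforce

text \<open>Two paths between \<open>a\<close> and \<open>b\<close> that meet only there form a cycle; both ends are counted twice.\<close>
lemma rings_parallel:
  assumes 1: "spans V E a b X m n" and 2: "spans W E b a Y m' n'"
    and disj: "V \<inter> W \<subseteq> {a, b}" and ab: "a \<noteq> b" and ne: "m \<le> n" "m' \<le> n'"
    and U: "V \<union> W \<subseteq> U" and Z: "Z \<subseteq> X \<union> Y"
    and lo: "m + m' \<le> lo + 2" "3 \<le> lo" and hi: "hi + 2 \<le> n + n'"
  shows "rings U E Z lo hi"
  unfolding rings_def
proof
  fix k assume k: "k \<in> {lo..hi}"
  then have "m + m' \<le> k + 2" "k + 2 \<le> n + n'" using lo hi by auto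
  then obtain i j where ij: "i \<in> {m..n}" "j \<in> {m'..n'}" "i + j = k + 2"
    using interval_sum_split[OF ne] by metis
  obtain p where p: "path V E p a b" "length p = i" "X \<subseteq> path_edges p"
    using 1 ij(1) unfolding spans_def by blast
  obtain q where q: "path W E q b a" "length q = j" "Y \<subseteq> path_edges q"
    using 2 ij(2) unfolding spans_def by blast
  obtain q1 where q1: "q = b # q1" using q(1) unfolding path_def by (cases q) auto
  have "q1 \<noteq> []" using q(1) ab unfolding path_def q1 by auto
  then obtain r where r: "q = b # r @ [a]"
    using q(1) unfolding path_def q1 by (metis append_butlast_last_id last_ConsR)
  let ?c = "p @ r"
  have hd: "hd ?c = a" using p(1) unfolding path_def by auto
  have "path_edges (p @ (r @ [a])) = path_edges p \<union> path_edges q"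
    using p(1) r by (auto simp: path_def path_edges_append path_edges_Cons)
  then have edges: "path_edges (?c @ [hd ?c]) = path_edges p \<union> path_edges q" using hd by simp
  have "set p \<inter> set r = {}"
    using p(1) q(1) disj unfolding path_def r by fastforce
  then have dist: "distinct ?c" using p(1) q(1) unfolding path_def r by auto
  have len: "length ?c = k" using p(2) q(2) r ij(3) by simp
  have "is_cycle U E ?c"
  proof (rule is_cycleI_walk[OF dist])
    show "3 \<le> length ?c" using len k lo(2) by simp
    show "set ?c \<subseteq> U" using p(1) q(1) U unfolding path_def r by auto
    show "path_edges (?c @ [hd ?c]) \<subseteq> E" using edges p(1) q(1) unfolding path_def by auto
  qed
  moreover have "Z \<subseteq> cycle_edges ?c"
    using edges Z p(1,3) q(3) cycle_edges_conv_path_edges[of ?c] by (auto simp: path_def)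
  ultimately show "\<exists>c. is_cycle U E c \<and> length c = k \<and> Z \<subseteq> cycle_edges c"
    using len by blast
qed

section \<open>Fans\<close>

text \<open>Only the presence of the rim and of the spokes is demanded, so the same edge set may contain
several fans, and a fan may be read from either end or shortened.\<close>
definition is_fan :: "'a set set \<Rightarrow> 'a \<Rightarrow> 'a list \<Rightarrow> bool" where
  "is_fan E f xs \<longleftrightarrow>
     distinct xs \<and> f \<notin> set xs \<and> path_edges xs \<subseteq> E \<and> (\<forall>x\<in>set xs. {f, x} \<in> E)"

lemma is_fan_rev: "is_fan E f xs \<Longrightarrow> is_fan E f (rev xs)"
  by (simp add: is_fan_def)

lemma fan_rim: "is_fan E f xs \<Longrightarrow> xs \<noteq> [] \<Longrightarrow>
    spans (set xs) E (hd xs) (last xs) (path_edges xs) (length xs) (length xs)"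
  by (rule pathI_spans[of _ _ xs]) (auto simp: path_def is_fan_def)

text \<open>Apart from the rim itself, all paths in a fan from one end of the rim to the other are of this
kind: leave the rim, pass through the hub, and come back further on, skipping \<open>ws\<close>.\<close>
lemma fan_detour:
  assumes "is_fan E f (us @ ws @ vs)" "us \<noteq> []" "vs \<noteq> []"
  shows "path (insert f (set (us @ ws @ vs))) E (us @ f # vs)
           (hd (us @ ws @ vs)) (last (us @ ws @ vs))"
    and "path_edges (us @ f # vs) = path_edges us \<union> {{f, last us}, {f, hd vs}} \<union> path_edges vs"
proof -
  show e: "path_edges (us @ f # vs) = path_edges us \<union> {{f, last us}, {f, hd vs}} \<union> path_edges vs"
    using assms(2,3) by (auto simp: path_edges_append path_edges_Cons)
  have "path_edges us \<union> path_edges vs \<subseteq> path_edges (us @ ws @ vs)"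
    using assms(2,3) by (cases "ws = []") (auto simp: path_edges_append)
  then have "path_edges (us @ f # vs) \<subseteq> E"
    using assms unfolding e is_fan_def by auto
  then show "path (insert f (set (us @ ws @ vs))) E (us @ f # vs)
           (hd (us @ ws @ vs)) (last (us @ ws @ vs))"
    using assms unfolding path_def is_fan_def by auto
qed

lemma fan_ascent:
  assumes "is_fan E f (us @ vs)" "us \<noteq> []"
  shows "spans (insert f (set (us @ vs))) E (hd (us @ vs)) f
           (path_edges us \<union> {{f, last us}}) (length us + 1) (length us + 1)"
proof (rule pathI_spans[of _ _ "us @ [f]"])
  have "path_edges us \<subseteq> path_edges (us @ vs)"
    using assms(2) by (cases "vs = []") (auto simp: path_edges_append)
  then show "path (insert f (set (us @ vs))) E (us @ [f]) (hd (us @ vs)) f"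
    using assms unfolding path_def is_fan_def by (auto simp: path_edges_append insert_commute)
qed (use assms(2) in \<open>auto simp: path_edges_append insert_commute\<close>)

text \<open>A stretch of the rim closes up through the hub. These are all cycles of a fan.\<close>
lemma fan_window:
  assumes "is_fan E f (us @ ws @ vs)" "2 \<le> length ws"
  shows "rings (insert f (set (us @ ws @ vs))) E
           (path_edges ws \<union> {{f, hd ws}, {f, last ws}}) (length ws + 1) (length ws + 1)"
proof -
  have ne: "ws \<noteq> []" using assms(2) by auto
  have sub: "path_edges ws \<subseteq> path_edges (us @ ws @ vs)"
    using ne by (cases "us = []"; cases "vs = []") (auto simp: path_edges_append)
  have e: "path_edges ((f # ws) @ [hd (f # ws)]) = path_edges ws \<union> {{f, hd ws}, {f, last ws}}"
    using ne by (auto simp: path_edges_append path_edges_Cons)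
  have "is_cycle (insert f (set (us @ ws @ vs))) E (f # ws)"
  proof (rule is_cycleI_walk)
    show "path_edges ((f # ws) @ [hd (f # ws)]) \<subseteq> E"
      unfolding e using assms(1) ne sub unfolding is_fan_def by auto
  qed (use assms in \<open>auto simp: is_fan_def\<close>)
  moreover have "cycle_edges (f # ws) = path_edges ws \<union> {{f, hd ws}, {f, last ws}}"
    using cycle_edges_conv_path_edges[of "f # ws"] e by simp
  ultimately show ?thesis unfolding rings_def by (intro ballI exI[of _ "f # ws"]) auto
qed

text \<open>The path keeps to the rim up to \<open>r\<close>, visits the hub, and returns to the rim at the place that
the prescribed order dictates, from the last rim vertex down to the successor of \<open>r\<close>.\<close>
lemma fan_spoke_through:
  assumes fan: "is_fan E f (us @ r # vs)" and vs: "vs \<noteq> []"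
  shows "spans (insert f (set (us @ r # vs))) E (hd (us @ r # vs)) (last (us @ r # vs)) {{f, r}}
           (length us + 3) (length (us @ r # vs) + 1)"
proof (rule spansI)
  fix k assume k: "length us + 3 \<le> k" "k \<le> length (us @ r # vs) + 1"
  define j where "j = length us + length vs + 2 - k"
  have j: "j < length vs" "length us + 2 + (length vs - j) = k" using k vs by (auto simp: j_def)
  have eq: "us @ r # vs = (us @ [r]) @ take j vs @ drop j vs" by simp
  have ne: "us @ [r] \<noteq> []" "drop j vs \<noteq> []" using j by auto
  note d = fan_detour[OF fan[unfolded eq] ne]
  show "spans (insert f (set (us @ r # vs))) E (hd (us @ r # vs)) (last (us @ r # vs)) {{f, r}} k k"
    unfolding eq
  proof (rule pathI_spans[OF d(1)])
    show "length ((us @ [r]) @ f # drop j vs) = k" using j by simp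
    show "{{f, r}} \<subseteq> path_edges ((us @ [r]) @ f # drop j vs)" unfolding d(2) by simp
  qed
qed

lemma fan_last_spoke_through:
  assumes fan: "is_fan E f (us @ [r])" and us: "us \<noteq> []"
  shows "spans (insert f (set (us @ [r]))) E (hd us) r {{f, r}} (length us + 2) (length us + 2)"
  using fan_detour[of E f us "[]" "[r]"] assms
  by (intro pathI_spans[of _ _ "us @ [f, r]"]) auto

lemma fan_through:
  assumes fan: "is_fan E f xs" and len: "2 \<le> length xs"
  shows "spans (insert f (set xs)) E (hd xs) (last xs) {} 3 (length xs + 1)"
proof -
  obtain r vs where xs: "xs = [] @ r # vs" "vs \<noteq> []"
    using len by (cases xs) (auto simp: Suc_le_eq)
  show ?thesis
    using fan_spoke_through[OF fan[unfolded xs(1)] xs(2)] unfolding xs(1)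
    by (rule spans_mono) auto
qed

text \<open>The longest path inserts the hub into a rim edge. Either the first or the last rim edge is
different from \<open>e\<close>, so the insertion can be made without losing \<open>e\<close>.\<close>
lemma fan_rim_through:
  assumes fan: "is_fan E f xs" and len: "3 \<le> length xs" and e: "e \<in> path_edges xs"
  shows "spans (insert f (set xs)) E (hd xs) (last xs) {e} (length xs) (length xs + 1)"
proof -
  obtain x y zs where xs: "xs = x # y # zs" "zs \<noteq> []"
    using len by (cases xs rule: path_edges.cases) (auto simp: Suc_le_eq)
  then have ne: "xs \<noteq> []" "tl xs \<noteq> []" "butlast xs \<noteq> []" by auto
  have tl: "xs = [hd xs] @ [] @ tl xs" and bl: "xs = butlast xs @ [] @ [last xs]"
    using ne by auto
  have "path_edges (tl xs) \<union> path_edges (butlast xs) = path_edges xs"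
  proof -
    have "path_edges xs = insert {x, y} (path_edges (tl xs))" using xs by simp
    moreover have "{x, y} \<in> path_edges (butlast xs)" using xs by simp
    moreover have "path_edges (butlast xs) \<subseteq> path_edges xs"
      by (subst (2) bl, subst path_edges_append) (use ne in auto)
    ultimately show ?thesis by (auto simp: xs)
  qed
  then consider "e \<in> path_edges (tl xs)" | "e \<in> path_edges (butlast xs)" using e by blast
  then have long: "spans (insert f (set xs)) E (hd xs) (last xs) {e} (length xs + 1) (length xs + 1)"
  proof cases
    case 1
    then show ?thesis
      using fan_detour[of E f "[hd xs]" "[]" "tl xs"] fan ne len
      by (intro pathI_spans[of _ _ "[hd xs] @ f # tl xs"]) auto
  next
    case 2
    then show ?thesis
      using fan_detour[of E f "butlast xs" "[]" "[last xs]"] fan ne len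
      by (intro pathI_spans[of _ _ "butlast xs @ f # [last xs]"]) auto
  qed
  have "spans (insert f (set xs)) E (hd xs) (last xs) {e} (length xs) (length xs)"
    using fan_rim[OF fan ne(1)] by (rule spans_mono) (use e in auto)
  from spans_join[OF this long] show ?thesis by simp
qed

lemma fan_to_hub:
  assumes fan: "is_fan E f xs"
  shows "spans (insert f (set xs)) E (hd xs) f {} 2 (length xs + 1)"
proof (rule spansI)
  fix k assume k: "2 \<le> k" "k \<le> length xs + 1"
  have eq: "xs = take (k - 1) xs @ drop (k - 1) xs" by simp
  have ne: "take (k - 1) xs \<noteq> []" using k by auto
  have "spans (insert f (set (take (k - 1) xs @ drop (k - 1) xs))) E
    (hd (take (k - 1) xs @ drop (k - 1) xs)) f
    (path_edges (take (k - 1) xs) \<union> {{f, last (take (k - 1) xs)}})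
    (length (take (k - 1) xs) + 1) (length (take (k - 1) xs) + 1)"
    by (rule fan_ascent) (use fan ne in auto)
  then have "spans (insert f (set xs)) E (hd xs) f
    (path_edges (take (k - 1) xs) \<union> {{f, last (take (k - 1) xs)}})
    (length (take (k - 1) xs) + 1) (length (take (k - 1) xs) + 1)" by simp
  then show "spans (insert f (set xs)) E (hd xs) f {} k k"
    by (rule spans_mono) (use k in auto)
qed

lemma fan_rim_to_hub:
  assumes fan: "is_fan E f xs" and "xs \<noteq> []"
  shows "spans (insert f (set xs)) E (hd xs) f (path_edges xs \<union> {{f, last xs}})
           (length xs + 1) (length xs + 1)"
  using fan_ascent[of E f xs "[]"] assms by simp

lemma fan_spoke_to_hub:
  assumes fan: "is_fan E f (us @ r # vs)"
  shows "spans (insert f (set (us @ r # vs))) E (hd (us @ r # vs)) f {{f, r}}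
           (length us + 2) (length us + 2)"
proof -
  have "is_fan E f ((us @ [r]) @ vs)" using fan by simp
  from fan_ascent[OF this] show ?thesis by (auto intro: spans_mono)
qed

lemma path_edge_window:
  assumes "e \<in> path_edges xs" "2 \<le> j" "j \<le> length xs"
  shows "\<exists>us ws vs. xs = us @ ws @ vs \<and> length ws = j \<and> e \<in> path_edges ws"
  using assms
proof (induction xs)
  case (Cons x xs)
  show ?case
  proof (cases "j = length (x # xs) \<or> e \<in> path_edges xs")
    case True
    then consider "j = length (x # xs)" | "j \<le> length xs" "e \<in> path_edges xs"
      using Cons.prems(3) by fastforce
    then show ?thesis
    proof cases
      case 1
      then show ?thesis using Cons.prems by (intro exI[of _ "[]"] exI[of _ "x # xs"]) auto
    next
      case 2
      then obtain us ws vs where "xs = us @ ws @ vs" "length ws = j" "e \<in> path_edges ws"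
        using Cons by blast
      then show ?thesis by (intro exI[of _ "x # us"] exI[of _ ws] exI[of _ vs]) simp
    qed
  next
    case False
    with Cons.prems obtain y ys where xs: "xs = y # ys" "e = {x, y}" by (cases xs) auto
    have "e \<in> path_edges (take j (x # xs))"
      using Cons.prems(2) xs by (cases j rule: nat.exhaust; cases "j - 1") auto
    then show ?thesis using Cons.prems(3)
      by (intro exI[of _ "[]"] exI[of _ "take j (x # xs)"] exI[of _ "drop j (x # xs)"]) auto
  qed
qed simp

lemma fan_rim_rings:
  assumes fan: "is_fan E f xs" and e: "e \<in> path_edges xs"
  shows "rings (insert f (set xs)) E {e} 3 (length xs + 1)"
proof (rule ringsI)
  fix k assume k: "3 \<le> k" "k \<le> length xs + 1"
  obtain us ws vs where w: "xs = us @ ws @ vs" "length ws = k - 1" "e \<in> path_edges ws"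
    using path_edge_window[OF e, of "k - 1"] k by force
  have "2 \<le> length ws" using w k by simp
  from fan_window[OF fan[unfolded w(1)] this] show "rings (insert f (set xs)) E {e} k k"
    unfolding w(1) by (rule rings_mono) (use w k in auto)
qed

lemma fan_spoke_rings:
  assumes fan: "is_fan E f (us @ r # vs)"
  shows "rings (insert f (set (us @ r # vs))) E {{f, r}} 3 (length vs + 2)"
proof (rule ringsI)
  fix k assume k: "3 \<le> k" "k \<le> length vs + 2"
  let ?ws = "r # take (k - 2) vs"
  have eq: "us @ r # vs = us @ ?ws @ drop (k - 2) vs" by simp
  have "2 \<le> length ?ws" using k by simp
  from fan_window[OF fan[unfolded eq] this]
  show "rings (insert f (set (us @ r # vs))) E {{f, r}} k k"
    unfolding eq[symmetric] by (rule rings_mono) (use k in auto)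
qed

section \<open>Caps: double fans with a distinguished hub\<close>

text \<open>What the rest of the construction needs to know about a double fan with ends \<open>a\<close> and \<open>u\<close> and
hub \<open>h\<close>. It can be crossed from \<open>a\<close> to \<open>u\<close>, also without \<open>h\<close>, and it connects either end with
\<open>h\<close>. The last clause is the point: where the cycles of lengths up to \<open>L\<close> inside the cap end, paths
leaving the cap through \<open>h\<close> or through \<open>u\<close> take over, because these start at orders smaller than
\<open>L\<close> by a margin of 6 or 4. The margin pays for the vertices that are needed to close such a path
up outside. A single fan has no margin: a spoke in the middle of its rim lies only on
cycles of about half the size of the fan, and every path through it from one end of the rim
to the other is as long. The condition \<open>w \<le> M\<close> makes the orders of paths
that avoid the inner part of a larger block meet those of the paths that cross it.\<close>
definition cap :: "'a set \<Rightarrow> 'a set set \<Rightarrow> 'a \<Rightarrow> 'a \<Rightarrow> 'a \<Rightarrow> bool" where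
  "cap V E a h u \<longleftrightarrow>
     simple_graph V E \<and> h \<in> V \<and> a \<in> V \<and> u \<in> V \<and> a \<noteq> u \<and> h \<noteq> a \<and> h \<noteq> u \<and> 23 \<le> card V \<and>
     spans V E a u {} 5 (card V) \<and> spans V E a h {} 3 (card V) \<and> spans V E h u {} 2 (card V) \<and>
     spans (V - {h}) E a u {} (card V - 7) (card V - 1) \<and>
     (\<forall>e\<in>E. \<exists>L x M w. rings V E {e} 3 L \<and> spans V E a h {e} x M \<and> spans V E a u {e} w (card V) \<and>
        x + 6 \<le> L \<and> w + 4 \<le> L \<and> x \<le> M \<and> w \<le> M \<and> L \<le> card V)"

definition double_fan :: "'a \<Rightarrow> 'a \<Rightarrow> 'a list \<Rightarrow> 'a \<Rightarrow> 'a list \<Rightarrow> 'a set set" where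
  "double_fan f h xs z ys =
     path_edges (xs @ [z]) \<union> (\<lambda>x. {f, x}) ` set (xs @ [z]) \<union>
     path_edges (z # ys) \<union> (\<lambda>y. {h, y}) ` set (z # ys) \<union> {{f, h}}"

text \<open>A double fan on \<open>m\<close> vertices has at most \<open>2m - 3\<close> edges, since \<open>m\<close> is the number of rim vertices
\<open>length xs + length ys + 1\<close> plus the two hubs.\<close>
lemma card_double_fan_le:
  "card (double_fan f h xs z ys) \<le> 2 * (length xs + length ys) + 3"
proof -
  have 1: "card (path_edges (xs @ [z])) \<le> length xs"
    using card_path_edges_le[of "xs @ [z]"] by simp
  have 2: "card (path_edges (z # ys)) \<le> length ys"
    using card_path_edges_le[of "z # ys"] by simp
  have 3: "card ((\<lambda>x. {f, x}) ` set (xs @ [z])) \<le> length xs + 1"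
    using card_image_le[of "set (xs @ [z])" "\<lambda>x. {f, x}"] card_length[of "xs @ [z]"] by simp
  have 4: "card ((\<lambda>y. {h, y}) ` set (z # ys)) \<le> length ys + 1"
    using card_image_le[of "set (z # ys)" "\<lambda>y. {h, y}"] card_length[of "z # ys"] by simp
  show ?thesis
    unfolding double_fan_def
    using card_Un_le[of "path_edges (xs @ [z])" "(\<lambda>x. {f, x}) ` set (xs @ [z])"]
      card_Un_le[of "path_edges (xs @ [z]) \<union> (\<lambda>x. {f, x}) ` set (xs @ [z])" "path_edges (z # ys)"]
      card_Un_le[of "path_edges (xs @ [z]) \<union> (\<lambda>x. {f, x}) ` set (xs @ [z]) \<union> path_edges (z # ys)"
        "(\<lambda>y. {h, y}) ` set (z # ys)"]
      card_Un_le[of "path_edges (xs @ [z]) \<union> (\<lambda>x. {f, x}) ` set (xs @ [z]) \<union> path_edges (z # ys)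
        \<union> (\<lambda>y. {h, y}) ` set (z # ys)" "{{f, h}}"] 1 2 3 4
    by simp
qed

text \<open>The edge \<open>fh\<close> lets each fan extend the cycles of the other. Both the cycles through
an edge and the paths through it are obtained by combining a piece in its own fan with an
arbitrary piece of the other one. The side of \<open>f\<close> is kept short and the side of \<open>h\<close> is about
twice as long or longer: an edge on the short side then finds long cycles in the other fan,
and an edge on the long side finds short paths by jumping over the rim of the short side.
The sizes 7 and 13 are the smallest ones for which the estimates in the proof give the margins.\<close>
lemma double_fan_cap:
  assumes dist: "distinct (f # h # xs @ z # ys)" and lx: "length xs = 7" and ly: "13 \<le> length ys"
  shows "cap (set (f # h # xs @ z # ys)) (double_fan f h xs z ys) (hd xs) h (last ys)"
proof -
  define V where "V = set (f # h # xs @ z # ys)"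
  define E where "E = double_fan f h xs z ys"
  define a where "a = hd xs"
  define u where "u = last ys"
  define j where "j = length ys"
  define FV where "FV = insert f (set (xs @ [z]))"
  define HV where "HV = insert h (set (z # ys))"
  have j: "13 \<le> j" using ly by (simp add: j_def)
  have ne: "xs \<noteq> []" "ys \<noteq> []" using lx ly by auto
  have cardV: "card V = j + 10" using distinct_card[OF dist] lx by (simp add: V_def j_def)
  have F: "is_fan E f (xs @ [z])" and H: "is_fan E h (z # ys)" and F0: "is_fan E f xs"
    and fh: "{f, h} \<in> E" "f \<noteq> h"
    using dist ne by (auto simp: is_fan_def E_def double_fan_def path_edges_append)
  have ends: "hd (xs @ [z]) = a" "last (xs @ [z]) = z" "hd (z # ys) = z" "last (z # ys) = u"
    "hd (rev (xs @ [z])) = z" "last (rev (xs @ [z])) = a" "hd (rev (z # ys)) = u" "hd xs = a"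
    using ne by (auto simp: a_def u_def hd_append last_rev hd_rev)
  have lens: "length (xs @ [z]) = 8" "length (z # ys) = j + 1" using lx by (auto simp: j_def)
  have sets: "FV \<subseteq> V" "HV \<subseteq> V" "FV \<inter> HV \<subseteq> {z}" "f \<notin> HV" "h \<notin> FV" "h \<in> HV" "f \<in> FV" "z \<in> FV" "z \<in> HV"
    "set (z # ys) \<subseteq> HV" "h \<notin> set (z # ys)" "h \<in> V" "f \<in> V" "FV \<inter> set (z # ys) \<subseteq> {z}"
    "set xs \<inter> HV = {}" "set xs \<subseteq> V" "set (z # ys) \<subseteq> V" "h \<notin> set xs" "f \<noteq> z" "h \<noteq> z"
    using dist by (auto simp: FV_def HV_def V_def)
  have setrev: "insert f (set (rev (xs @ [z]))) = FV" "insert h (set (rev (z # ys))) = HV"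
    by (auto simp: FV_def HV_def)
  note Frev = is_fan_rev[OF F] and Hrev = is_fan_rev[OF H]
  have F1: "spans FV E a z {} 3 9"
    using fan_through[OF F] lens(1) ends by (simp add: FV_def)
  have F2: "spans FV E a f {} 2 9"
    using fan_to_hub[OF F] lens(1) ends by (simp add: FV_def)
  have F3: "spans FV E z f {} 2 9"
    using fan_to_hub[OF Frev] unfolding setrev ends length_rev lens by simp
  have F4: "spans (insert f (set xs)) E a f {} 2 8"
    using fan_to_hub[OF F0] lx ends by simp
  have H1: "spans HV E z u {} 3 (j + 2)"
    using fan_through[OF H] lens(2) ends j by (simp add: HV_def)
  have H2: "spans HV E z h {} 2 (j + 2)"
    using fan_to_hub[OF H] lens(2) ends by (simp add: HV_def)
  have H3: "spans HV E h u {} 2 (j + 2)"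
    using spans_rev[OF fan_to_hub[OF Hrev]] unfolding setrev ends length_rev lens by simp
  have H4: "spans (set (z # ys)) E z u {} (j + 1) (j + 1)"
    using fan_rim[OF H] unfolding ends lens by (auto intro: spans_mono)
  have FH: "spans {f, h} E f h {{f, h}} 2 2" using spans_edge[OF fh] .
  \<comment> \<open>Paths between the hub and the end of one fan through the other fan: they close up
    cycles that start in the former.\<close>
  have K: "spans (insert f HV) E f z {{f, h}} 3 (j + 3)"
    by (rule spans_series[OF FH spans_rev[OF H2]]) (use sets in auto)
  have G: "spans (insert h FV) E h z {} 3 10"
    by (rule spans_series[OF spans_rev[OF FH] spans_rev[OF F3]]) (use sets in auto)
  have S1: "spans V E a u {} 5 (j + 10)"
    by (rule spans_series[OF F1 H1]) (use sets j in auto)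
  have "spans V E a h {} 3 10"
    by (rule spans_series[OF F2 FH]) (use sets j in auto)
  moreover have "spans V E a h {} 4 (j + 10)"
    by (rule spans_series[OF F1 H2]) (use sets j in auto)
  ultimately have S2: "spans V E a h {} 3 (j + 10)" by (rule spans_join) simp
  have "spans V E h u {} 2 (j + 2)" using H3 by (rule spans_mono) (use sets in auto)
  moreover have "spans V E h u {} (j + 3) (j + 10)"
    by (rule spans_series[OF G H4]) (use sets j in auto)
  ultimately have S3: "spans V E h u {} 2 (j + 10)" by (rule spans_join) simp
  have S4: "spans (V - {h}) E a u {} (j + 3) (j + 9)"
    by (rule spans_series[OF F1 H4]) (use sets j in auto)
  have S4': "spans (V - {h}) E a u {} (card V - 7) (card V - 1)"
  proof -
    have "card V - 7 = j + 3" "card V - 1 = j + 9" using cardV by auto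
    then show ?thesis using S4 by (simp only:)
  qed
  have edges: "\<exists>L x M w. rings V E {e} 3 L \<and> spans V E a h {e} x M \<and> spans V E a u {e} w (j + 10) \<and>
      x + 6 \<le> L \<and> w + 4 \<le> L \<and> x \<le> M \<and> w \<le> M \<and> L \<le> j + 10" if eE: "e \<in> E" for e
  proof -
    consider (Frim) "e \<in> path_edges (xs @ [z])" | (Fspoke) r where "r \<in> set (xs @ [z])" "e = {f, r}"
      | (Hrim) "e \<in> path_edges (z # ys)" | (Hspoke) r where "r \<in> set (z # ys)" "e = {h, r}"
      | (hubs) "e = {f, h}"
      using eE unfolding E_def double_fan_def by blast
    then show ?thesis
    proof cases
      case Frim
      have "rings V E {e} 3 9"
        using fan_rim_rings[OF F Frim] by (rule rings_mono) (use sets lens in \<open>auto simp: FV_def\<close>)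
      moreover have long: "spans FV E z f {e} 9 9"
        using fan_rim_to_hub[OF Frev] unfolding setrev ends length_rev lens path_edges_rev
        by (rule spans_mono) (use Frim in auto)
      have "rings V E {e} 10 (j + 10)"
        by (rule rings_parallel[OF long K]) (use sets j in auto)
      ultimately have "rings V E {e} 3 (j + 10)" by (rule rings_join) simp
      moreover have thr: "spans FV E a z {e} 8 9"
        using fan_rim_through[OF F _ Frim] unfolding ends lens by (simp add: FV_def)
      have "spans V E a h {e} 9 (j + 10)"
        by (rule spans_series[OF thr H2]) (use sets j in auto)
      moreover have "spans V E a u {e} 10 (j + 10)"
        by (rule spans_series[OF thr H1]) (use sets j in auto)
      ultimately show ?thesis using j
        by (intro exI[of _ "j + 10"] exI[of _ 9] exI[of _ "j + 10"] exI[of _ 10]) auto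
    next
      case (Fspoke r)
      obtain us vs where split: "xs @ [z] = us @ r # vs" using Fspoke(1) by (meson split_list)
      have revsplit: "rev (xs @ [z]) = rev vs @ r # rev us" by (simp only: split) simp
      have uv: "length us + length vs = 7" using arg_cong[OF split, of length] lx by simp
      have "rings V E {e} 3 (length vs + 2)"
        using fan_spoke_rings[OF F[unfolded split]]
        by (rule rings_mono) (use sets Fspoke split[symmetric] in \<open>auto simp: FV_def\<close>)
      moreover have long: "spans FV E z f {e} (length vs + 2) (length vs + 2)"
        using fan_spoke_to_hub[OF Frev[unfolded revsplit]]
        unfolding revsplit[symmetric] setrev ends by (simp add: Fspoke)
      \<comment> \<open>The cycle runs from \<open>f\<close> over \<open>r\<close> along the rim to \<open>z\<close> and returns through the other fan. There
        \<open>j \<ge> 13\<close> makes it long even if \<open>r = z\<close>.\<close>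
      have "rings V E {e} (length vs + 3) (length vs + j + 3)"
        by (rule rings_parallel[OF long K]) (use sets j in auto)
      ultimately have "rings V E {e} 3 (length vs + j + 3)" by (rule rings_join) simp
      moreover have thr: "spans FV E a z {e} 9 9"
      proof (cases "vs = []")
        case False
        then have "0 < length vs" by simp
        then have us6: "length us \<le> 6" using uv by linarith
        show ?thesis
          using fan_spoke_through[OF F[unfolded split] False]
          unfolding split[symmetric] ends lens
          by (rule spans_mono) (use us6 Fspoke in \<open>auto simp: FV_def\<close>)
      next
        case True
        then have "us = xs" "r = z" using split by auto
        then show ?thesis
          using fan_last_spoke_through[OF F ne(1)] Fspoke lx ends by (simp add: FV_def)
      qed
      have "spans V E a h {e} 10 (j + 10)"
        by (rule spans_series[OF thr H2]) (use sets j in auto)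
      moreover have "spans V E a u {e} 11 (j + 10)"
        by (rule spans_series[OF thr H1]) (use sets j in auto)
      ultimately show ?thesis using j uv
        by (intro exI[of _ "length vs + j + 3"] exI[of _ 10] exI[of _ "j + 10"] exI[of _ 11]) auto
    next
      case Hrim
      have "rings V E {e} 3 (j + 2)"
        using fan_rim_rings[OF H Hrim] by (rule rings_mono) (use sets lens in \<open>auto simp: HV_def\<close>)
      moreover have long: "spans HV E z h {e} (j + 2) (j + 2)"
        using fan_rim_to_hub[OF H] unfolding ends lens
        by (rule spans_mono) (use Hrim in \<open>auto simp: HV_def\<close>)
      have "rings V E {e} (j + 3) (j + 10)"
        by (rule rings_parallel[OF long G]) (use sets j in auto)
      ultimately have "rings V E {e} 3 (j + 10)" by (rule rings_join) simp
      moreover have "spans V E a h {e} (j + 4) (j + 10)"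
        by (rule spans_series[OF F1 long]) (use sets j in auto)
      moreover have thr: "spans HV E z u {e} (j + 1) (j + 2)"
        using fan_rim_through[OF H _ Hrim] j unfolding ends lens by (simp add: HV_def)
      have "spans V E a u {e} (j + 3) (j + 10)"
        by (rule spans_series[OF F1 thr]) (use sets j in auto)
      ultimately show ?thesis using j
        by (intro exI[of _ "j + 10"] exI[of _ "j + 4"] exI[of _ "j + 10"] exI[of _ "j + 3"]) auto
    next
      case (Hspoke r)
      obtain us vs where split: "z # ys = us @ r # vs" using Hspoke(1) by (meson split_list)
      have revsplit: "rev (z # ys) = rev vs @ r # rev us" by (simp only: split) simp
      have uv: "length us + length vs = j" using arg_cong[OF split, of length] lens by simp
      have "rings V E {e} 3 (length us + 2)"
        using fan_spoke_rings[OF Hrev[unfolded revsplit]] unfolding revsplit[symmetric] setrev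
        by (rule rings_mono) (use sets Hspoke in auto)
      moreover have long: "spans HV E z h {e} (length us + 2) (length us + 2)"
        using fan_spoke_to_hub[OF H[unfolded split]]
        unfolding split[symmetric] ends by (simp add: Hspoke HV_def)
      \<comment> \<open>The cycle returns from \<open>r\<close> along the rim to \<open>z\<close> and then takes up the whole of the fan of \<open>f\<close>,
        which the paths leaving through \<open>h\<close> or \<open>u\<close> may jump over; this difference is the margin.\<close>
      have "rings V E {e} (length us + 3) (length us + 10)"
        by (rule rings_parallel[OF long G]) (use sets j in auto)
      ultimately have "rings V E {e} 3 (length us + 10)" by (rule rings_join) simp
      moreover have "spans V E a h {e} (length us + 4) (length us + 10)"
        by (rule spans_series[OF F1 long]) (use sets j in auto)
      moreover have "spans V E a u {e} (length us + 5) (j + 10)"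
      proof (cases "vs = []")
        case False
        then have "0 < length vs" by simp
        then have usj: "length us < j" using uv by linarith
        have "spans HV E z u {e} (length us + 3) (j + 2)"
          using fan_spoke_through[OF H[unfolded split] False]
          unfolding split[symmetric] ends lens using Hspoke by (simp add: HV_def)
        then show ?thesis
          by (rule spans_series[OF F1]) (use usj sets in auto)
      next
        case True
        have uh: "us \<noteq> []" using True uv j by auto
        then have "hd us = z" "r = u" using split True ends by (auto simp: u_def hd_append Cons_eq_append_conv)
        moreover have "spans (insert h (set (us @ [r]))) E (hd us) r {{h, r}} (length us + 2) (length us + 2)"
          using fan_last_spoke_through[of E h us r] H uh True split by simp
        ultimately have "spans HV E z u {e} (length us + 2) (length us + 2)"
          using split True Hspoke by (simp add: HV_def)
        then show ?thesis
          by (rule spans_series[OF F1]) (use uv True sets in auto)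
      qed
      ultimately show ?thesis using j uv
        by (intro exI[of _ "length us + 10"] exI[of _ "length us + 4"] exI[of _ "length us + 10"]
            exI[of _ "length us + 5"]) auto
    next
      case hubs
      have "rings V E {e} 3 (j + 10)"
        by (rule rings_parallel[OF F3 K]) (use sets j hubs in auto)
      moreover have "spans V E a h {e} 3 10"
        by (rule spans_series[OF F2 FH]) (use sets j hubs in auto)
      \<comment> \<open>The first fan is used without \<open>z\<close>, which is left to the second one.\<close>
      moreover have af: "spans (insert h (insert f (set xs))) E a h {e} 3 9"
        by (rule spans_series[OF F4 FH]) (use sets j hubs in auto)
      have "spans V E a u {e} 4 (j + 10)"
        by (rule spans_series[OF af H3]) (use sets j hubs in auto)
      ultimately show ?thesis using j
        by (intro exI[of _ "j + 10"] exI[of _ 3] exI[of _ 10] exI[of _ 4]) auto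
    qed
  qed
  have "simple_graph V E"
  proof -
    have "e \<subseteq> V \<and> card e = 2" if "e \<in> E" for e
    proof -
      have d: "distinct (xs @ [z])" "distinct (z # ys)" using dist by auto
      show ?thesis
        using that path_edges_simple[OF d(1), of e] path_edges_simple[OF d(2), of e] dist
        unfolding E_def double_fan_def V_def by (auto simp: card_insert_if)
    qed
    then show ?thesis by (auto simp: simple_graph_def V_def)
  qed
  moreover have "a \<in> set xs" "u \<in> set ys" using ne by (auto simp: a_def u_def)
  moreover have "a \<in> V" "u \<in> V" "h \<in> V" "a \<noteq> u" "h \<noteq> a" "h \<noteq> u"
    using calculation dist by (auto simp: V_def)
  ultimately show ?thesis
    using S1 S2 S3 S4' edges j cardV
    unfolding cap_def V_def[symmetric] E_def[symmetric] a_def[symmetric] u_def[symmetric]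
    by simp
qed

lemma simple_graph_Un: "simple_graph V E \<Longrightarrow> simple_graph W F \<Longrightarrow> simple_graph (V \<union> W) (E \<union> F)"
  unfolding simple_graph_def by blast

section \<open>Blocks and their composition\<close>

text \<open>For each edge \<open>e\<close>, cycles through \<open>e\<close> inside the block have all lengths up to \<open>L\<close>, and paths
through \<open>e\<close> from end to end take over from the order \<open>l\<close> onwards: they are closed up to cycles
outside the block, and no length is missed if at most \<open>L - l + 1\<close> further vertices suffice
for that. With the margin 4 this holds when the outside is another block.\<close>
definition block :: "'a set \<Rightarrow> 'a set set \<Rightarrow> 'a \<Rightarrow> 'a \<Rightarrow> bool" where
  "block V E a b \<longleftrightarrow>
     simple_graph V E \<and> a \<in> V \<and> b \<in> V \<and> a \<noteq> b \<and> 5 \<le> card V \<and> spans V E a b {} 5 (card V) \<and>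
     (\<forall>e\<in>E. \<exists>l L. rings V E {e} 3 L \<and> spans V E a b {e} l (card V) \<and> l + 4 \<le> L \<and> L \<le> card V)"

text \<open>The weaker property that survives when two blocks are put in series: crossing the other block
adds at least 4 vertices to the paths through an edge, which consumes the margin, and the
shortest paths from end to end now have \<open>5 + 5 - 1\<close> vertices. A slot is what may be enclosed
between two caps. The bound \<open>2 \<le> L\<close> ensures that \<open>L + 1\<close> is a possible length of a cycle.\<close>
definition slot :: "'a set \<Rightarrow> 'a set set \<Rightarrow> 'a \<Rightarrow> 'a \<Rightarrow> bool" where
  "slot V E a b \<longleftrightarrow>
     simple_graph V E \<and> a \<in> V \<and> b \<in> V \<and> a \<noteq> b \<and> 9 \<le> card V \<and> spans V E a b {} 9 (card V) \<and>
     (\<forall>e\<in>E. \<exists>L. rings V E {e} 3 L \<and> spans V E a b {e} L (card V) \<and> 2 \<le> L \<and> L \<le> card V)"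

lemma block_rev: "block V E a b \<Longrightarrow> block V E b a"
  unfolding block_def spans_sym[of V E a b] by auto

lemma slot_rev: "slot V E a b \<Longrightarrow> slot V E b a"
  unfolding slot_def spans_sym[of V E a b] by auto

lemma cap_block:
  assumes "cap V E a h u" shows "block V E a u"
proof -
  have "\<exists>l L. rings V E {e} 3 L \<and> spans V E a u {e} l (card V) \<and> l + 4 \<le> L \<and> L \<le> card V"
    if "e \<in> E" for e
    using assms that unfolding cap_def by blast
  then show ?thesis using assms unfolding cap_def block_def by simp
qed

lemma finite_simple_graph: "simple_graph V E \<Longrightarrow> finite V"
  by (simp add: simple_graph_def)

text \<open>Every path crosses the other block in at least 5 vertices, one of which is shared.\<close>
lemma block_series_edges:
  assumes 1: "block V E a b" and 2: "block W F b c" and disj: "V \<inter> W = {b}"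
    and N: "card (V \<union> W) + 1 = card V + card W" and e: "e \<in> E"
  shows "\<exists>L. rings (V \<union> W) (E \<union> F) {e} 3 L \<and>
           spans (V \<union> W) (E \<union> F) a c {e} L (card (V \<union> W)) \<and> 2 \<le> L \<and> L \<le> card (V \<union> W)"
proof -
  obtain l L where L: "rings V E {e} 3 L" "spans V E a b {e} l (card V)" "l + 4 \<le> L" "L \<le> card V"
    using 1 e unfolding block_def by blast
  have cW: "5 \<le> card W" "spans W F b c {} 5 (card W)" using 2 unfolding block_def by auto
  have "rings (V \<union> W) (E \<union> F) {e} 3 L" using L(1) by (rule rings_mono) auto
  moreover have "spans V (E \<union> F) a b {e} l (card V)" "spans W (E \<union> F) b c {} 5 (card W)"
    using spans_supergraph[OF L(2)] spans_supergraph[OF cW(2)] by simp_all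
  then have "spans (V \<union> W) (E \<union> F) a c {e} L (card (V \<union> W))"
    by (rule spans_series) (use L(3,4) cW(1) disj N in auto)
  ultimately show ?thesis using L(3,4) N cW(1) by (intro exI[of _ L]) auto
qed

lemma card_Un_one:
  assumes "finite V" "finite W" "V \<inter> W = {b}"
  shows "card (V \<union> W) + 1 = card V + card W"
  using card_Un_Int[OF assms(1,2)] assms(3) by simp

lemma block_series:
  assumes 1: "block V E a b" and 2: "block W F b c" and disj: "V \<inter> W = {b}"
  shows "slot (V \<union> W) (E \<union> F) a c"
proof -
  have g: "simple_graph V E" "simple_graph W F" using 1 2 unfolding block_def by auto
  have N: "card (V \<union> W) + 1 = card V + card W"
    using card_Un_one[OF _ _ disj] g finite_simple_graph by blast
  have c: "5 \<le> card V" "5 \<le> card W" using 1 2 unfolding block_def by auto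
  have "spans V E a b {} 5 (card V)" "spans W F b c {} 5 (card W)"
    using 1 2 unfolding block_def by auto
  then have "spans V (E \<union> F) a b {} 5 (card V)" "spans W (E \<union> F) b c {} 5 (card W)"
    by (auto elim: spans_supergraph)
  then have "spans (V \<union> W) (E \<union> F) a c {} 9 (card (V \<union> W))"
    by (rule spans_series) (use c disj N in auto)
  moreover have "\<exists>L. rings (V \<union> W) (E \<union> F) {e} 3 L \<and>
      spans (V \<union> W) (E \<union> F) a c {e} L (card (V \<union> W)) \<and> 2 \<le> L \<and> L \<le> card (V \<union> W)" if "e \<in> E \<union> F" for e
    using that
  proof
    assume "e \<in> E"
    then show ?thesis by (rule block_series_edges[OF 1 2 disj N])
  next
    assume "e \<in> F"
    then show ?thesis
      using block_series_edges[OF block_rev[OF 2] block_rev[OF 1], of e] disj N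
      by (simp add: Un_commute Int_commute add.commute spans_sym[of _ _ c a])
  qed
  moreover have "a \<noteq> c" using 1 2 disj unfolding block_def by blast
  ultimately show ?thesis
    using 1 2 g c N simple_graph_Un[OF g] unfolding slot_def block_def by auto
qed

lemma cap_spans:
  assumes "cap V E a h u"
  shows "spans V E a u {} 5 (card V)" "spans V E a h {} 3 (card V)" "spans V E h u {} 2 (card V)"
    "spans (V - {h}) E a u {} (card V - 7) (card V - 1)"
    "spans V E h a {} 3 (card V)" "spans V E u h {} 2 (card V)"
    "spans (V - {h}) E u a {} (card V - 7) (card V - 1)"
  using assms unfolding cap_def by (simp_all add: spans_sym[of _ _ h a] spans_sym[of _ _ u])

text \<open>A path through \<open>e\<close> from \<open>a\<close> to \<open>b\<close> either jumps over the slot via the common hub, or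
crosses the slot and then has to leave the hub to the first cap. The orders of the two kinds
form one interval.\<close>
lemma cap_edges:
  assumes S: "slot V E u v" and X: "cap X P a h u" and Y: "cap Y Q b h v"
    and int: "X \<inter> V = {u}" "Y \<inter> V = {v}" "X \<inter> Y = {h}"
    and N: "N + 3 = card X + card V + card Y" and G: "P \<union> E \<union> Q \<subseteq> G"
    and U: "X \<union> V \<union> Y = U" and e: "e \<in> P"
  shows "\<exists>l L. rings U G {e} 3 L \<and> spans U G a b {e} l N \<and> l + 4 \<le> L \<and> L \<le> N"
proof -
  obtain L x M w where L: "rings X P {e} 3 L" "spans X P a h {e} x M"
    "spans X P a u {e} w (card X)" "x + 6 \<le> L" "w + 4 \<le> L" "x \<le> M" "w \<le> M" "L \<le> card X"
    using X e unfolding cap_def by blast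
  have c: "23 \<le> card X" "23 \<le> card Y" "9 \<le> card V" using S X Y unfolding cap_def slot_def by auto
  have XG: "spans X G a h {e} x M" "spans X G a u {e} w (card X)"
    using G by (auto intro!: spans_supergraph[OF L(2)] spans_supergraph[OF L(3)])
  have YG: "spans Y G h b {} 3 (card Y)" "spans (Y - {h}) G v b {} (card Y - 7) (card Y - 1)"
    using cap_spans[OF Y] G by (auto intro!: spans_supergraph[of _ Q _ _ _ _ _ G])
  have VG: "spans V G u v {} 9 (card V)"
    using S G unfolding slot_def by (auto intro!: spans_supergraph[of V E _ _ _ _ _ G])
  have skip: "spans U G a b {e} (x + 2) (M + card Y - 1)"
    by (rule spans_series[OF XG(1) YG(1)]) (use L c int U in auto)
  have XV: "spans (X \<union> V) G a v {e} (w + 8) (card X + card V - 1)"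
    by (rule spans_series[OF XG(2) VG]) (use L c int in auto)
  have disj: "(X \<union> V) \<inter> (Y - {h}) \<subseteq> {v}" using int by auto
  have full: "spans U G a b {e} (w + card Y) N"
    by (rule spans_series[OF XV YG(2) disj]) (use L c N U in auto)
  have "spans U G a b {e} (x + 2) N"
    using skip full by (rule spans_join) (use L c in auto)
  moreover have "rings U G {e} 3 L" using L(1) by (rule rings_mono) (use U G in auto)
  ultimately show ?thesis using L c N by (intro exI[of _ "x + 2"] exI[of _ L]) auto
qed

text \<open>Two caps with a common hub \<open>h\<close>, one at each end of a slot. Cycles that run from \<open>h\<close> through the
first cap, the slot and the second cap back to \<open>h\<close> need only one vertex more than the path in the
slot. For an edge of the slot they continue the cycles inside the slot up to the full number
of vertices, so the lost margin is restored. For the paths without a prescribed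
edge, \<open>h\<close> is a shortcut: they may have as few as 5 vertices, however large the slot is.
This is why the construction can be repeated.\<close>
lemma capped_slot:
  assumes S: "slot V E u v" and X: "cap X P a h u" and Y: "cap Y Q b h v"
    and int: "X \<inter> V = {u}" "Y \<inter> V = {v}" "X \<inter> Y = {h}"
  shows "block (X \<union> V \<union> Y) (P \<union> E \<union> Q) a b"
    and "card (X \<union> V \<union> Y) + 3 = card X + card V + card Y"
proof -
  define U where "U = X \<union> V \<union> Y"
  define G where "G = P \<union> E \<union> Q"
  have g: "simple_graph X P" "simple_graph V E" "simple_graph Y Q"
    using S X Y unfolding cap_def slot_def by auto
  have fin: "finite X" "finite V" "finite Y" using g finite_simple_graph by auto
  have uv: "u \<in> V" "v \<in> V" "u \<noteq> v" "h \<noteq> u" "h \<noteq> v" "u \<in> X" "v \<in> Y" "h \<in> X" "h \<in> Y"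
    using S X Y unfolding cap_def slot_def by auto
  have ab: "a \<noteq> b" "a \<in> X" "b \<in> Y" using X Y int unfolding cap_def by auto
  have "(X \<union> V) \<inter> Y = {v, h}" using int uv by auto
  then have N: "card U + 3 = card X + card V + card Y"
    using card_Un_one[OF fin(1,2) int(1)] card_Un_Int[of "X \<union> V" Y] fin uv unfolding U_def by simp
  then show "card (X \<union> V \<union> Y) + 3 = card X + card V + card Y" unfolding U_def .
  have c: "23 \<le> card X" "23 \<le> card Y" "9 \<le> card V" using S X Y unfolding cap_def slot_def by auto
  have sub: "P \<subseteq> G" "E \<subseteq> G" "Q \<subseteq> G" unfolding G_def by auto
  have XG: "spans X G a u {} 5 (card X)" "spans X G a h {} 3 (card X)" "spans X G h u {} 2 (card X)"
    using cap_spans[OF X] by (auto intro!: spans_supergraph[OF _ sub(1)])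
  have YG: "spans Y G h b {} 3 (card Y)" "spans (Y - {h}) G v b {} (card Y - 7) (card Y - 1)"
    "spans Y G v h {} 2 (card Y)"
    using cap_spans[OF Y] by (auto intro!: spans_supergraph[OF _ sub(3)])
  have VG: "spans V G u v {} 9 (card V)"
    using S unfolding slot_def by (auto intro!: spans_supergraph[OF _ sub(2)])
  have disj: "(X \<union> V) \<inter> (Y - {h}) \<subseteq> {v}" using int by auto
  have skip: "spans U G a b {} 5 (card X + card Y - 1)"
    by (rule spans_series[OF XG(2) YG(1)]) (use c int in \<open>auto simp: U_def\<close>)
  have XV: "spans (X \<union> V) G a v {} 13 (card X + card V - 1)"
    by (rule spans_series[OF XG(1) VG]) (use c int in auto)
  have full: "spans U G a b {} (5 + card Y) (card U)"
    by (rule spans_series[OF XV YG(2) disj]) (use c N in \<open>auto simp: U_def\<close>)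
  have "spans U G a b {} 5 (card U)"
    using skip full by (rule spans_join) (use c in auto)
  moreover have "\<exists>l L. rings U G {e} 3 L \<and> spans U G a b {e} l (card U) \<and> l + 4 \<le> L \<and> L \<le> card U"
    if eG: "e \<in> G" for e
  proof -
    have GU: "P \<union> E \<union> Q \<subseteq> G" "X \<union> V \<union> Y = U" "Q \<union> E \<union> P \<subseteq> G" "Y \<union> V \<union> X = U"
      by (auto simp: U_def G_def)
    have int': "Y \<inter> X = {h}" and N': "card U + 3 = card Y + card V + card X"
      using int(3) N by (simp_all add: Int_commute)
    consider "e \<in> P" | "e \<in> E" | "e \<in> Q" using eG unfolding G_def by blast
    then show ?thesis
    proof cases
      case 1
      then show ?thesis
        by (intro cap_edges[OF S X Y int N GU(1) GU(2) 1])
    next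
      case 3
      have "\<exists>l L. rings U G {e} 3 L \<and> spans U G b a {e} l (card U) \<and> l + 4 \<le> L \<and> L \<le> card U"
        by (rule cap_edges[OF slot_rev[OF S] Y X int(2) int(1) int' N' GU(3) GU(4) 3])
      then show ?thesis by (simp only: spans_sym[of U G b a])
    next
      case 2
      obtain L where L: "rings V E {e} 3 L" "spans V E u v {e} L (card V)" "2 \<le> L" "L \<le> card V"
        using S 2 unfolding slot_def by blast
      have Ve: "spans V G u v {e} L (card V)"
        using L(2) by (rule spans_mono) (auto simp: G_def)
      have XVe: "spans (X \<union> V) G a v {e} (L + 4) (card X + card V - 1)"
        by (rule spans_series[OF XG(1) Ve]) (use c L int in auto)
      have path: "spans U G a b {e} (L + card Y - 4) (card U)"
        by (rule spans_series[OF XVe YG(2) disj]) (use c L N in \<open>auto simp: U_def\<close>)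
      \<comment> \<open>The cycles through \<open>h\<close> start at \<open>L + 1\<close>: the hub is adjacent to both ends of the slot.\<close>
      have hV: "spans (X \<union> V) G h v {e} (L + 1) (card X + card V - 1)"
        by (rule spans_series[OF XG(3) Ve]) (use c L int in auto)
      have "rings V G {e} 3 L"
        using L(1) by (rule rings_mono) (auto simp: G_def)
      then have "rings U G {e} 3 L" by (rule rings_mono) (auto simp: U_def)
      moreover have "rings U G {e} (L + 1) (card U)"
        by (rule rings_parallel[OF hV YG(3)]) (use c L N uv int in \<open>auto simp: U_def\<close>)
      ultimately have "rings U G {e} 3 (card U)" by (rule rings_join) simp
      then show ?thesis using path L c N
        by (intro exI[of _ "L + card Y - 4"] exI[of _ "card U"]) auto
    qed
  qed
  moreover have "simple_graph U G" unfolding U_def G_def using g simple_graph_Un by blast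
  moreover have "a \<in> U" "b \<in> U" "5 \<le> card U" using ab c N by (auto simp: U_def)
  ultimately show "block (X \<union> V \<union> Y) (P \<union> E \<union> Q) a b"
    using ab(1) unfolding block_def U_def[symmetric] G_def[symmetric] by blast
qed

section \<open>Closing up, and counting edges\<close>

text \<open>Closing a block with a second one uses up 3 of the margin 4: the outside path has at least 5
vertices, two of them shared.\<close>
lemma block_parallel_edges:
  assumes 1: "block V E a b" and 2: "block W F a b" and disj: "V \<inter> W = {a, b}"
    and N: "N + 2 = card V + card W" and e: "e \<in> E"
  shows "rings (V \<union> W) (E \<union> F) {e} 3 N"
proof -
  obtain l L where L: "rings V E {e} 3 L" "spans V E a b {e} l (card V)" "l + 4 \<le> L" "L \<le> card V"
    using 1 e unfolding block_def by blast
  have c: "5 \<le> card W" "5 \<le> card V" "a \<noteq> b" using 1 2 unfolding block_def by auto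
  have p: "spans V (E \<union> F) a b {e} l (card V)" using L(2) by (rule spans_mono) auto
  have q: "spans W (E \<union> F) b a {} 5 (card W)"
    using block_rev[OF 2] unfolding block_def by (auto intro!: spans_supergraph[of W F])
  have "rings (V \<union> W) (E \<union> F) {e} 3 L" using L(1) by (rule rings_mono) auto
  moreover have "rings (V \<union> W) (E \<union> F) {e} (l + 3) N"
    by (rule rings_parallel[OF p q]) (use L c N disj in auto)
  ultimately show ?thesis by (rule rings_join) (use L in auto)
qed

lemma block_parallel:
  assumes 1: "block V E a b" and 2: "block W F a b" and disj: "V \<inter> W = {a, b}"
  shows "edge_pancyclic (V \<union> W) (E \<union> F)" and "card (V \<union> W) + 2 = card V + card W"
proof -
  have fin: "finite V" "finite W" using 1 2 finite_simple_graph unfolding block_def by auto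
  have ab: "a \<noteq> b" using 1 unfolding block_def by auto
  show N: "card (V \<union> W) + 2 = card V + card W"
    using card_Un_Int[OF fin] disj ab by simp
  have "rings (V \<union> W) (E \<union> F) {e} 3 (card (V \<union> W))" if "e \<in> E \<union> F" for e
    using that
  proof
    assume "e \<in> E"
    then show ?thesis by (rule block_parallel_edges[OF 1 2 disj N])
  next
    assume "e \<in> F"
    then show ?thesis
      using block_parallel_edges[OF 2 1, of "card (V \<union> W)" e] disj N
      by (simp add: Un_commute Int_commute add.commute)
  qed
  then show "edge_pancyclic (V \<union> W) (E \<union> F)"
    unfolding edge_pancyclic_def rings_def by auto
qed

lemma fresh_nats:
  fixes A :: "nat set"
  assumes "finite A"
  shows "\<exists>zs. length zs = k \<and> distinct zs \<and> set zs \<inter> A = {}"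
proof -
  have "infinite (- A)" using assms by (simp add: finite_compl)
  then obtain B where "finite B" "card B = k" "B \<subseteq> - A"
    using infinite_arbitrarily_large by blast
  moreover then obtain zs where "set zs = B" "distinct zs" using finite_distinct_list by blast
  ultimately show ?thesis using distinct_card by (intro exI[of _ zs]) fastforce
qed

lemma cap_exists:
  fixes A :: "nat set"
  assumes fin: "finite A" and d: "distinct [a, h, u]" and j: "13 \<le> j"
  shows "\<exists>V E. cap V E a h u \<and> card V = j + 10 \<and> card E \<le> 2 * j + 17 \<and> V \<inter> A \<subseteq> {a, h, u}"
proof -
  obtain zs where zs: "length zs = j + 7" "distinct zs" "set zs \<inter> (A \<union> {a, h, u}) = {}"
    using fresh_nats[of "A \<union> {a, h, u}" "j + 7"] fin by blast
  obtain f z r where r: "zs = f # z # r" using zs(1) by (cases zs rule: path_edges.cases) auto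
  define xs where "xs = a # take 6 r"
  define ys where "ys = drop 6 r @ [u]"
  have sr: "set (take 6 r) \<union> set (drop 6 r) = set r" by (metis append_take_drop_id set_append)
  have dr: "set (take 6 r) \<inter> set (drop 6 r) = {}" "distinct (take 6 r)" "distinct (drop 6 r)"
    using zs(2) r by (auto simp: set_take_disj_set_drop_if_distinct)
  have lens: "length xs = 7" "length ys = j" using zs(1) r j by (auto simp: xs_def ys_def)
  have dist: "distinct (f # h # xs @ z # ys)"
    using zs(2,3) d dr sr unfolding r xs_def ys_def by auto
  have "cap (set (f # h # xs @ z # ys)) (double_fan f h xs z ys) a h u"
    using double_fan_cap[OF dist lens(1)] lens j by (simp add: xs_def ys_def)
  moreover have "card (set (f # h # xs @ z # ys)) = j + 10"
    using distinct_card[OF dist] lens by simp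
  moreover have "card (double_fan f h xs z ys) \<le> 2 * j + 17"
    using card_double_fan_le[of f h xs z ys] lens by simp
  moreover have "set (f # h # xs @ z # ys) \<inter> A \<subseteq> {a, h, u}"
    using zs(3) sr unfolding r xs_def ys_def by auto
  ultimately show ?thesis by blast
qed

text \<open>One step puts a new cap \<open>W\<close> in series with the block and encloses both between two caps \<open>X\<close> and
\<open>Y\<close> with a common hub. Three caps of 23 vertices and at most 43 edges are added, and four
identifications of vertices are made, so there are 65 new vertices and at most 129 new edges:
one edge fewer than two per new vertex. The parameter \<open>j\<close> of the initial cap adjusts the number
of vertices modulo 65.\<close>
lemma sparse_blocks:
  assumes j: "13 \<le> j"
  shows "\<exists>(V :: nat set) E a b. block V E a b \<and> card V = j + 10 + 65 * k \<and>
           card E + k + 3 \<le> 2 * card V"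
proof (induction k)
  case 0
  obtain V E where "cap V E 0 1 (2::nat)" "card V = j + 10" "card E \<le> 2 * j + 17"
    using cap_exists[of "{}" 0 1 2 j] j by auto
  then show ?case using cap_block by fastforce
next
  case (Suc k)
  then obtain V :: "nat set" and E a b where V: "block V E a b" "card V = j + 10 + 65 * k"
    "card E + k + 3 \<le> 2 * card V" by blast
  have finV: "finite V" and ab: "a \<in> V" "b \<in> V" "a \<noteq> b"
    using V(1) finite_simple_graph unfolding block_def by auto
  obtain zs where zs: "length zs = 2" "distinct zs" "set zs \<inter> V = {}"
    using fresh_nats[OF finV] by blast
  then obtain c g where cg: "c \<noteq> g" "c \<notin> V" "g \<notin> V"
    by (cases zs rule: path_edges.cases) auto
  obtain W F where W: "cap W F c g b" "card W = 23" "card F \<le> 43" "W \<inter> V \<subseteq> {c, g, b}"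
    using cap_exists[OF finV, of c g b 13] cg ab by auto
  have bc: "b \<in> W" "c \<in> W" "b \<noteq> c" "finite W"
    using W(1) finite_simple_graph unfolding cap_def by auto
  have VW: "V \<inter> W = {b}" using W(4) cg ab bc by auto
  have slot: "slot (V \<union> W) (E \<union> F) a c"
    using block_series[OF V(1) block_rev[OF cap_block[OF W(1)]] VW] .
  have cardVW: "card (V \<union> W) + 1 = card V + 23" using card_Un_one[OF finV bc(4) VW] W(2) by simp
  have fin: "finite (V \<union> W)" using finV bc by simp
  obtain ws where ws: "length ws = 3" "distinct ws" "set ws \<inter> (V \<union> W) = {}"
    using fresh_nats[OF fin] by blast
  then obtain d h d' where new: "distinct [d, h, d']" "{d, h, d'} \<inter> (V \<union> W) = {}"
    by (cases ws rule: path_edges.cases; cases "tl (tl ws)") auto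
  have ac: "a \<noteq> c" using cg ab by auto
  obtain X P where X: "cap X P d h a" "card X = 23" "card P \<le> 43"
    "X \<inter> (V \<union> W \<union> {d'}) \<subseteq> {d, h, a}"
    using cap_exists[of "V \<union> W \<union> {d'}" d h a 13] fin new ab by auto
  have finX: "finite X" and Xin: "d \<in> X" "h \<in> X" "a \<in> X"
    using X(1) finite_simple_graph unfolding cap_def by auto
  obtain Y Q where Y: "cap Y Q d' h c" "card Y = 23" "card Q \<le> 43"
    "Y \<inter> (V \<union> W \<union> X) \<subseteq> {d', h, c}"
    using cap_exists[of "V \<union> W \<union> X" d' h c 13] fin finX new bc by auto
  have Yin: "d' \<in> Y" "h \<in> Y" "c \<in> Y" using Y(1) unfolding cap_def by auto
  have int1: "X \<inter> (V \<union> W) = {a}" using X(4) new ab Xin by auto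
  have int2: "Y \<inter> (V \<union> W) = {c}" using Y(4) new bc Yin by auto
  have "d' \<notin> X" using X(4) new ab by auto
  moreover have "c \<notin> X" using int1 bc ac by auto
  ultimately have int3: "X \<inter> Y = {h}" using Y(4) Xin Yin by auto
  note capped = capped_slot[OF slot X(1) Y(1) int1 int2 int3]
  have "card (P \<union> (E \<union> F) \<union> Q) \<le> card E + 129"
    using card_Un_le[of "P \<union> (E \<union> F)" Q] card_Un_le[of P "E \<union> F"] card_Un_le[of E F]
      W(3) X(3) Y(3) by linarith
  then show ?case
    using capped cardVW V(2,3) X(2) Y(2)
    by (intro exI[of _ "X \<union> (V \<union> W) \<union> Y"] exI[of _ "P \<union> (E \<union> F) \<union> Q"] exI[of _ d] exI[of _ d'])
      (auto simp: algebra_simps)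
qed

text \<open>The block is closed with one more cap, which shares both ends with it and therefore adds 21
vertices and at most 43 edges.\<close>
lemma sparse_edge_pancyclic:
  assumes n: "44 \<le> n"
  shows "\<exists>(V :: nat set) E. simple_graph V E \<and> card V = n \<and> E \<noteq> {} \<and> edge_pancyclic V E \<and>
           65 * card E + n \<le> 65 * (2 * n)"
proof -
  define k where "k = (n - 44) div 65"
  define j where "j = 13 + (n - 44) mod 65"
  have j: "13 \<le> j" by (simp add: j_def)
  have njk: "n = j + 31 + 65 * k"
    using n div_mult_mod_eq[of "n - 44" 65] by (simp add: j_def k_def)
  have nk: "n \<le> 65 * k + 130" using njk mod_less_divisor[of 65 "n - 44"] by (simp add: j_def)
  obtain V :: "nat set" and E a b where V: "block V E a b" "card V = j + 10 + 65 * k"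
    "card E + k + 3 \<le> 2 * card V"
    using sparse_blocks[OF j] by blast
  have finV: "finite V" and ab: "a \<in> V" "b \<in> V" "a \<noteq> b"
    using V(1) finite_simple_graph unfolding block_def by auto
  obtain zs where "length zs = 1" "set zs \<inter> V = {}"
    using fresh_nats[OF finV] by blast
  then obtain h where h: "h \<notin> V" by (cases zs) auto
  obtain W F where W: "cap W F a h b" "card W = 23" "card F \<le> 43" "W \<inter> V \<subseteq> {a, h, b}"
    using cap_exists[OF finV, of a h b 13] h ab by auto
  have VW: "V \<inter> W = {a, b}" using W(1,4) h ab unfolding cap_def by auto
  note par = block_parallel[OF V(1) cap_block[OF W(1)] VW]
  have card: "card (V \<union> W) = n" using par(2) V(2) W(2) njk by simp
  have g: "simple_graph (V \<union> W) (E \<union> F)"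
    using V(1) W(1) simple_graph_Un unfolding block_def cap_def by blast
  have "card (E \<union> F) + k + 2 \<le> 2 * n"
    using card_Un_le[of E F] V(2,3) W(3) njk by linarith
  then have "65 * card (E \<union> F) + n \<le> 65 * (2 * n)" using nk by linarith
  moreover have "E \<noteq> {}"
  proof -
    have "5 \<in> {5..card V}" using V(2) by simp
    then obtain p where p: "path V E p a b" "length p = 5"
      using V(1) unfolding block_def spans_def by blast
    then obtain x y zs where "p = x # y # zs" by (cases p rule: path_edges.cases) auto
    then have "{x, y} \<in> E" using p(1) unfolding path_def by auto
    then show ?thesis by blast
  qed
  ultimately show ?thesis using par(1) card g by blast
qed

theorem theorem1p9:
  fixes s l n :: nat
  assumes "real s \<ge> exp 8"
    and "l = nat \<lceil>real s / ln (real s)\<rceil>"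
    and "n = (100 * s - 1) * s ^ l"
  shows "\<exists>(V :: nat set) E. simple_graph V E \<and> card V = n \<and> E \<noteq> {} \<and> edge_pancyclic V E \<and>
           real (card E) \<le> 2 * real n - real n / (200 * ln (real n))"
proof -
  have "9 \<le> exp (8 :: real)" using exp_ge_add_one_self[of 8] by simp
  then have s: "9 \<le> s" using assms(1) by linarith
  then have "1 \<le> s ^ l" by simp
  then have "(100 * s - 1) * 1 \<le> n" unfolding assms(3) by (rule mult_le_mono2)
  then have n: "899 \<le> n" using s by linarith
  have "exp 1 \<le> real n" using exp_le n by linarith
  then have ln: "1 \<le> ln (real n)" using n by (simp add: ln_ge_iff)
  obtain V :: "nat set" and E where G: "simple_graph V E" "card V = n" "E \<noteq> {}" "edge_pancyclic V E"
    "65 * card E + n \<le> 65 * (2 * n)"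
    using sparse_edge_pancyclic[of n] n by auto
  have "real n / (200 * ln (real n)) \<le> real n / 65"
    by (rule divide_left_mono) (use ln in auto)
  moreover have "65 * real (card E) + real n \<le> 65 * (2 * real n)"
    using G(5) by (metis (mono_tags) of_nat_add of_nat_le_iff of_nat_mult of_nat_numeral)
  ultimately have "real (card E) \<le> 2 * real n - real n / (200 * ln (real n))" by linarith
  then show ?thesis using G by blast
qed

end
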